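(* Let $q$ be a nonzero complex number such that $q^m\neq 1$ for every integer $m\geq 1$. Then every irreducible finite-dimensional complex representation of the algebra $GL_2$ (the algebraic structure of the Dipper–Donkin quantization of $GL_2$ with parameter $q$) is one-dimensional.
   Context: The algebraic structure of the Dipper–Donkin quantum $GL_2$ is the associative unital $\mathbb{C}$-algebra generated by $c_{11},c_{12},c_{21},c_{22}$ together with a formal two-sided inverse $d^{-1}$ of the quantum determinant $d=c_{11}c_{22}-c_{12}c_{21}$, subject to the relations $$c_{11}c_{12}=c_{12}c_{11},\qquad c_{21}c_{11}=q\,c_{11}c_{21},\qquad c_{22}c_{12}=q\,c_{12}c_{22},$$ $$c_{21}c_{22}=c_{22}c_{21},\qquad c_{21}c_{12}=q\,c_{12}c_{21},\qquad c_{22}c_{11}-c_{11}c_{22}=(q-1)\,c_{12}c_{21}.$$ Thus an $n$-dimensional representation $c_{ij}\mapsto C_{ij}$ consists of $n\times n$ complex matrices $C_{ij}$ satisfying these relations such that $C_{11}C_{22}-C_{12}C_{21}$ is invertible. *)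

theory Defs
  imports "HOL-Analysis.Analysis"
begin

(* Matrix multiplication is **; the operator * on the type complex^'n^'n acts entrywise.
   Accordingly the multiple of a matrix A by a complex scalar q is written mat q ** A. *)

definition quantum_det ::
    "complex^'n^'n \<Rightarrow> complex^'n^'n \<Rightarrow> complex^'n^'n \<Rightarrow> complex^'n^'n \<Rightarrow> complex^'n^'n" where
  "quantum_det C11 C12 C21 C22 = C11 ** C22 - C12 ** C21"

definition GL2_representation ::
    "complex \<Rightarrow> complex^'n^'n \<Rightarrow> complex^'n^'n \<Rightarrow> complex^'n^'n \<Rightarrow> complex^'n^'n \<Rightarrow> bool" where
  "GL2_representation q C11 C12 C21 C22 \<longleftrightarrow>
     C11 ** C12 = C12 ** C11 \<and>
     C21 ** C11 = mat q ** (C11 ** C21) \<and>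
     C22 ** C12 = mat q ** (C12 ** C22) \<and>
     C21 ** C22 = C22 ** C21 \<and>
     C21 ** C12 = mat q ** (C12 ** C21) \<and>
     C22 ** C11 - C11 ** C22 = mat (q - 1) ** (C12 ** C21) \<and>
     invertible (quantum_det C11 C12 C21 C22)"

definition invariant_subspace :: "(complex^'n^'n) set \<Rightarrow> (complex^'n) set \<Rightarrow> bool" where
  "invariant_subspace S W \<longleftrightarrow> vec.subspace W \<and> (\<forall>A\<in>S. \<forall>w\<in>W. A *v w \<in> W)"

(* The algebra is generated by the c_ij and the inverse of d, so its submodules are the subspaces
   stable under the images of these five elements.  The space complex^'n is never zero, because
   index types are nonempty. *)
definition irreducible_GL2_representation ::
    "complex \<Rightarrow> complex^'n^'n \<Rightarrow> complex^'n^'n \<Rightarrow> complex^'n^'n \<Rightarrow> complex^'n^'n \<Rightarrow> bool" where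
  "irreducible_GL2_representation q C11 C12 C21 C22 \<longleftrightarrow>
     GL2_representation q C11 C12 C21 C22 \<and>
     (\<forall>W. invariant_subspace {C11, C12, C21, C22, matrix_inv (quantum_det C11 C12 C21 C22)} W
        \<longrightarrow> W = {0} \<or> W = UNIV)"

end

theory Submission
  imports Defs "HOL-Complex_Analysis.Complex_Analysis"
begin

text \<open>The quantum determinant \<open>d\<close> satisfies \<open>d c\<^sub>1\<^sub>2 = q c\<^sub>1\<^sub>2 d\<close> and \<open>c\<^sub>2\<^sub>1 d = q d c\<^sub>2\<^sub>1\<close>.
  Taking ordinary determinants and using \<open>q\<^sup>n \<noteq> 1\<close> shows that \<open>C\<^sub>1\<^sub>2\<close> and \<open>C\<^sub>2\<^sub>1\<close> are singular.
  A matrix that commutes with all generators up to scalars has an invariant kernel, so by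
  irreducibility it vanishes as soon as it is singular.  Hence \<open>C\<^sub>1\<^sub>2 = 0\<close>, then \<open>C\<^sub>2\<^sub>1 = 0\<close>, and the
  remaining generators commute; applying the same principle to \<open>C\<^sub>1\<^sub>1 - \<lambda>\<close> and \<open>C\<^sub>2\<^sub>2 - \<mu>\<close> for
  eigenvalues \<open>\<lambda>\<close>, \<open>\<mu>\<close> shows that all generators act by scalars, so every line is invariant.\<close>

lemma mat_mult_vec: "mat r *v (v::'a::comm_semiring_1^'n) = r *s v"
  by (vector matrix_vector_mult_def mat_def)
     (simp add: if_distrib if_distribR sum.delta cong: if_cong)

lemma mat_commute: "A ** mat r = mat r ** (A::'a::comm_semiring_1^'n^'n)"
  by (vector matrix_matrix_mult_def mat_def)
    (simp add: if_distrib if_distribR sum.delta sum.delta' mult.commute cong: if_cong)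

lemma matrix_mul_diff_left: "(A - B) ** C = A ** C - B ** (C::'a::ring_1^'n^'n)"
  by (simp add: matrix_eq matrix_vector_mult_diff_rdistrib flip: matrix_vector_mul_assoc)

lemma matrix_mul_diff_right: "C ** (A - B) = C ** A - C ** (B::'a::ring_1^'n^'n)"
  by (simp add: matrix_eq matrix_vector_mult_diff_rdistrib matrix_vector_mult_diff_distrib
      flip: matrix_vector_mul_assoc)

lemma det_mat: "det (mat r :: 'a::comm_ring_1^'n^'n) = r ^ CARD('n)"
proof -
  have "det (mat r :: 'a^'n^'n) = (\<Prod>i\<in>UNIV. (mat r :: 'a^'n^'n) $ i $ i)"
    by (rule det_diagonal) (simp add: mat_def)
  then show ?thesis by (simp add: mat_def)
qed

text \<open>Determinants turn the scalar matrix into the factor \<open>r ^ CARD('n)\<close>, and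
  \<open>det D\<close> cancels. The disjunction lets the scalar stand on either side: the first form
  fits \<open>C12\<close>, the second \<open>C21\<close>, with \<open>D\<close> the quantum
  determinant.\<close>

lemma singular_if_quasi_commute:
  fixes D M :: "'a::field^'n^'n"
  assumes "invertible D" and "r ^ CARD('n) \<noteq> 1"
    and "D ** M = mat r ** (M ** D) \<or> M ** D = mat r ** (D ** M)"
  shows "det M = 0"
proof -
  have "det D \<noteq> 0" using assms(1) by (simp add: invertible_det_nz)
  moreover have "det M * det D = r ^ CARD('n) * (det M * det D)"
    using assms(3) by (metis det_mul det_mat mult.commute)
  ultimately show ?thesis using assms(2) by simp
qed

text \<open>Existence of an eigenvalue: by Liouville's theorem an entire function whose modulus
  tends to infinity has a zero.\<close>

lemma exists_singular_shift:
  fixes A :: "complex^'n^'n"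
  obtains z where "det (A - mat z) = 0"
proof (rule Liouville_weak_inverse)
  show "(\<lambda>z. det (A - mat z)) holomorphic_on UNIV"
  proof -
    have "(\<lambda>z. (A - mat z) $ i $ j) holomorphic_on UNIV" for i j
      by (cases "i = j") (auto simp: mat_def intro: holomorphic_intros)
    then show ?thesis
      unfolding det_def
      by (intro holomorphic_on_sum holomorphic_on_mult holomorphic_on_prod holomorphic_on_const)
  qed
next
  fix B :: real
  \<comment> \<open>For z \<noteq> 0, det(A - z) = z^n det(z^(-1) A - 1). Substituting w = 1/z, the
    second factor tends to (-1)^n \<noteq> 0, so the growth of z^n decides.\<close>
  let ?g = "\<lambda>z. det (mat (inverse z) ** A - mat 1)"
  have "((\<lambda>w. det (mat w ** A - mat 1)) \<longlongrightarrow> det (mat 0 ** A - mat 1 :: complex^'n^'n)) (at 0)"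
  proof -
    have entry: "(mat w ** A) $ i $ j = w * A $ i $ j" for w i j
      by (simp add: matrix_matrix_mult_def mat_def if_distrib if_distribR cong: if_cong)
    have "((\<lambda>w. (mat w ** A - mat 1) $ i $ j) \<longlongrightarrow> (mat 0 ** A - mat 1) $ i $ j) (at 0)" for i j
      by (simp only: vector_minus_component entry) (intro tendsto_intros)
    then show ?thesis
      unfolding det_def by (intro tendsto_sum tendsto_mult tendsto_prod tendsto_const)
  qed
  moreover have "det (mat 0 ** A - mat 1 :: complex^'n^'n) = (- 1) ^ CARD('n)"
  proof -
    have "mat 0 ** A - mat 1 = (mat (- 1) :: complex^'n^'n)"
      by (simp add: vec_eq_iff matrix_matrix_mult_def mat_def)
    then show ?thesis by (simp add: det_mat)
  qed
  ultimately have "((\<lambda>w. det (mat w ** A - mat 1)) \<longlongrightarrow> (- 1) ^ CARD('n)) (at 0)"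
    by simp
  then have "(?g \<longlongrightarrow> (- 1) ^ CARD('n)) at_infinity"
    by (rule filterlim_compose) (simp add: filterlim_inverse_at_iff filterlim_ident)
  moreover have "filterlim (\<lambda>z::complex. z ^ CARD('n)) at_infinity at_infinity"
    by (intro filterlim_power_at_infinity filterlim_ident) simp
  ultimately have "filterlim (\<lambda>z. ?g z * z ^ CARD('n)) at_infinity at_infinity"
    by (intro tendsto_mult_filterlim_at_infinity[of _ "(- 1) ^ CARD('n)"]) simp_all
  then have "\<forall>\<^sub>F z in at_infinity. B \<le> cmod (?g z * z ^ CARD('n))"
    by (simp add: filterlim_at_infinity_conv_norm_at_top filterlim_at_top)
  moreover have "\<forall>\<^sub>F z::complex in at_infinity. z \<noteq> 0"
    by (rule eventually_not_equal_at_infinity)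
  ultimately show "\<forall>\<^sub>F z in at_infinity. B \<le> cmod (det (A - mat z))"
  proof eventually_elim
    case (elim z)
    have "A - mat z = mat z ** (mat (inverse z) ** A - mat 1)"
      using elim by (simp add: matrix_eq mat_mult_vec matrix_vector_mult_diff_rdistrib
          flip: matrix_vector_mul_assoc)
    then have "det (A - mat z) = ?g z * z ^ CARD('n)"
      by (metis det_mul det_mat mult.commute)
    then show ?case using elim by simp
  qed
qed

text \<open>As \<open>D\<close> is injective, the image of \<open>W\<close> under \<open>D\<close>
  has the same dimension as \<open>W\<close> and lies in \<open>W\<close>, hence equals
  \<open>W\<close>; so \<open>D\<close> can be undone inside \<open>W\<close>.\<close>

lemma subspace_matrix_inv_closed:
  fixes D :: "'a::field^'n^'n"
  assumes "vec.subspace W" "invertible D" "\<And>w. w \<in> W \<Longrightarrow> D *v w \<in> W" "w \<in> W"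
  shows "matrix_inv D *v w \<in> W"
proof -
  have inv: "matrix_inv D *v (D *v x) = x" for x
  proof -
    have "matrix_inv D ** D = mat 1"
      using someI_ex[OF assms(2)[unfolded invertible_def]] by (simp add: matrix_inv_def)
    then show ?thesis by (simp add: matrix_vector_mul_assoc)
  qed
  then have "inj ((*v) D)" by (metis injI)
  then have "vec.dim ((*v) D ` W) = vec.dim W"
    by (intro vec.dim_image_eq) (auto intro: inj_on_subset)
  then have "(*v) D ` W = W"
    using assms by (intro vec.subspace_dim_equal vec.subspace_image) auto
  then show ?thesis using inv assms(4) by (metis imageE)
qed

text \<open>Stability under the generators gives stability under the quantum determinant, hence
  under its inverse, so that the inverse need not be checked in later uses.\<close>

lemma irreducible_imp_trivial_subspace:
  assumes "irreducible_GL2_representation q C11 C12 C21 C22"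
    and "invariant_subspace {C11, C12, C21, C22} W"
  shows "W = {0} \<or> W = UNIV"
proof -
  let ?d = "quantum_det C11 C12 C21 C22"
  have W: "vec.subspace W" "\<And>A w. A \<in> {C11, C12, C21, C22} \<Longrightarrow> w \<in> W \<Longrightarrow> A *v w \<in> W"
    using assms(2) unfolding invariant_subspace_def by auto
  have "?d *v w \<in> W" if "w \<in> W" for w
    using that W unfolding quantum_det_def
    by (simp add: matrix_vector_mult_diff_rdistrib vec.subspace_diff flip: matrix_vector_mul_assoc)
  moreover have "invertible ?d"
    using assms(1) by (simp add: irreducible_GL2_representation_def GL2_representation_def)
  ultimately have "matrix_inv ?d *v w \<in> W" if "w \<in> W" for w
    using subspace_matrix_inv_closed W(1) that by blast
  then have "invariant_subspace {C11, C12, C21, C22, matrix_inv ?d} W"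
    using W unfolding invariant_subspace_def by auto
  then show ?thesis
    using assms(1) by (simp add: irreducible_GL2_representation_def)
qed

text \<open>A variant of Schur's lemma: the kernel of \<open>M\<close> is invariant and nonzero,
  hence everything. The scalar \<open>s\<close> may vary with \<open>A\<close>.\<close>

lemma irreducible_quasi_central_eq_0:
  assumes "irreducible_GL2_representation q C11 C12 C21 C22"
    and quasi: "\<And>A. A \<in> {C11, C12, C21, C22} \<Longrightarrow> \<exists>s. M ** A = mat s ** (A ** M)"
    and "det M = 0"
  shows "M = 0"
proof -
  define W where "W = {w. M *v w = 0}"
  have "A *v w \<in> W" if A: "A \<in> {C11, C12, C21, C22}" and w: "w \<in> W" for A w
  proof -
    obtain s where "M ** A = mat s ** (A ** M)" using quasi A by blast
    then have "M *v (A *v w) = mat s *v (A *v (M *v w))"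
      by (simp add: matrix_vector_mul_assoc)
    then show ?thesis using w by (simp add: W_def)
  qed
  moreover have "vec.subspace W"
    by (auto simp: W_def vec.subspace_def matrix_vector_right_distrib vec.scale)
  ultimately have "W = {0} \<or> W = UNIV"
    using irreducible_imp_trivial_subspace[OF assms(1)] unfolding invariant_subspace_def by blast
  obtain w where "M *v w = 0" "w \<noteq> 0"
    using assms(3) by (metis invertible_det_nz invertible_left_inverse matrix_left_invertible_ker)
  then have "W \<noteq> {0}"
    by (auto simp: W_def)
  with \<open>W = {0} \<or> W = UNIV\<close> have "W = UNIV" by blast
  then show ?thesis
    by (simp add: W_def matrix_eq set_eq_iff)
qed

lemma GL2_quantum_det_relations:
  assumes "GL2_representation q C11 C12 C21 C22"
  shows "quantum_det C11 C12 C21 C22 ** C12 = mat q ** (C12 ** quantum_det C11 C12 C21 C22)"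
    and "C21 ** quantum_det C11 C12 C21 C22 = mat q ** (quantum_det C11 C12 C21 C22 ** C21)"
proof -
  have rels: "C11 ** C12 = C12 ** C11" "C21 ** C11 = mat q ** (C11 ** C21)"
    "C22 ** C12 = mat q ** (C12 ** C22)" "C21 ** C22 = C22 ** C21"
    "C21 ** C12 = mat q ** (C12 ** C21)"
    using assms by (auto simp: GL2_representation_def)
  \<comment> \<open>With products bracketed to the right, a relation must also be applicable at the
    head of a longer word; \<open>left\<close> provides that form, and \<open>pull\<close> moves
    scalars to the front. Both sides then reach the same normal form.\<close>
  have left: "X ** (Y ** Z) = R ** Z" if "X ** Y = R" for X Y Z R :: "complex^'n^'n"
    using that by (simp add: matrix_mul_assoc)
  have pull: "X ** (mat q ** Y) = mat q ** (X ** Y)" for X Y :: "complex^'n^'n"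
    by (metis mat_commute matrix_mul_assoc)
  note normalise = quantum_det_def matrix_mul_diff_left matrix_mul_diff_right
    rels rels[THEN left] pull
  show "quantum_det C11 C12 C21 C22 ** C12 = mat q ** (C12 ** quantum_det C11 C12 C21 C22)"
    "C21 ** quantum_det C11 C12 C21 C22 = mat q ** (quantum_det C11 C12 C21 C22 ** C21)"
    by (simp_all add: normalise flip: matrix_mul_assoc)
qed

theorem theorem2:
  fixes q :: complex and C11 C12 C21 C22 :: "complex^'n^'n"
  assumes "q \<noteq> 0"
    and "\<forall>m::nat. m \<ge> 1 \<longrightarrow> q ^ m \<noteq> 1"
    and "irreducible_GL2_representation q C11 C12 C21 C22"
  shows "CARD('n) = 1"
proof -
  let ?d = "quantum_det C11 C12 C21 C22"
  have rep: "GL2_representation q C11 C12 C21 C22"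
    using assms(3) by (simp add: irreducible_GL2_representation_def)
  have rels: "C11 ** C12 = C12 ** C11" "C21 ** C11 = mat q ** (C11 ** C21)"
    "C22 ** C12 = mat q ** (C12 ** C22)" "C21 ** C22 = C22 ** C21"
    "C21 ** C12 = mat q ** (C12 ** C21)"
    "C22 ** C11 - C11 ** C22 = mat (q - 1) ** (C12 ** C21)" "invertible ?d"
    using rep by (auto simp: GL2_representation_def)
  have qn: "q ^ CARD('n) \<noteq> 1"
    using assms(2) by (simp add: Suc_leI)
  note quasi_central = irreducible_quasi_central_eq_0[OF assms(3)]
  \<comment> \<open>\<open>quasi_central\<close> wants \<open>M\<close> as the left factor, whereas
    two relations express \<open>C22 ** C12\<close> and \<open>C21 ** C12\<close>. They are inverted
    using q \<noteq> 0.\<close>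
  have cancel: "X = mat (inverse q) ** Y" if "Y = mat q ** X" for X Y :: "complex^'n^'n"
    using that assms(1)
    by (simp add: matrix_eq mat_mult_vec flip: matrix_vector_mul_assoc)
  have comm: "\<exists>s. X ** Y = mat s ** (Y ** X)" if "X ** Y = Y ** X" for X Y :: "complex^'n^'n"
    using that by (intro exI[of _ 1]) simp
  have "det C12 = 0" "det C21 = 0"
    using singular_if_quasi_commute[OF rels(7) qn] GL2_quantum_det_relations[OF rep] by blast+
  have "C12 = 0"
    using \<open>det C12 = 0\<close> comm rels(1) cancel[OF rels(3)] cancel[OF rels(5)]
    by (intro quasi_central) (auto)
  moreover have "C21 = 0"
    using \<open>det C21 = 0\<close> comm rels(2,4,5) by (intro quasi_central) auto
  ultimately have 0: "C12 = 0" "C21 = 0" "C22 ** C11 = C11 ** C22"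
    using rels(6) by auto
  have scalar: "\<exists>z. A = mat z" if "A = C11 \<or> A = C22" for A
  proof -
    obtain z where z: "det (A - mat z) = 0" by (rule exists_singular_shift)
    have "(A - mat z) ** B = B ** (A - mat z)" if "B \<in> {C11, C12, C21, C22}" for B
      using that \<open>A = C11 \<or> A = C22\<close> 0
      by (auto simp: matrix_mul_diff_left matrix_mul_diff_right mat_commute)
    then have "A - mat z = 0"
      using comm z by (intro quasi_central) blast+
    then show ?thesis by auto
  qed
  obtain x y where xy: "C11 = mat x" "C22 = mat y"
    using scalar by blast
  \<comment> \<open>The all-ones vector serves as a concrete nonzero vector. Scalar matrices
    preserve the line it spans, which is therefore the whole space.\<close>
  define v :: "complex^'n" where "v = 1"
  have "v \<noteq> 0" by (simp add: v_def)
  have "invariant_subspace {C11, C12, C21, C22} (vec.span {v})"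
    unfolding invariant_subspace_def
    by (auto simp: xy 0 mat_mult_vec vec.span_scale vec.span_zero)
  then have "vec.span {v} = UNIV"
    using irreducible_imp_trivial_subspace[OF assms(3)] \<open>v \<noteq> 0\<close> vec.span_base[of v "{v}"] by blast
  then have "vec.dim {v} = CARD('n)"
    by (metis vec.dim_span vec_dim_card)
  then show ?thesis
    using \<open>v \<noteq> 0\<close> vec.dim_eq_card_independent[of "{v}"] by simp
qed

end
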